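(* For every integer $n \geq 1$, we have $$\operatorname{lcm}(1, 2, \dots, n) \geq 2^{n-1}.$$
   Context: $\operatorname{lcm}(1, 2, \dots, n)$ denotes the (positive) least common multiple of the integers $1, 2, \dots, n$. *)

theory Defs
  imports Complex_Main
begin

end

(* The numbers 1 / ((m + 1) * binomial m k) form Leibniz's harmonic triangle: each entry is the
   difference of an entry of the previous row and its left neighbour, so every entry of row m is
   an integer combination of 1/1, ..., 1/(m + 1).  Hence (m + 1) * binomial m k divides every
   common multiple L of 1, ..., m + 1; thus binomial m k <= L / (m + 1), and summing over the
   m + 1 values of k gives 2^m <= L. *)
theory Submission
  imports Defs
begin

text \<open>With \<open>m = k + d\<close>, absorption makes both row \<open>Suc m\<close> binomials
  multiples of \<open>m choose k\<close>, by the factors (m+1)/(k+1) and (m+1)/(d+1). Their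
  reciprocals then add up with numerator (k+1) + (d+1) = m+2, which cancels the factor
  \<open>Suc (Suc m)\<close>.\<close>

lemma leibniz_harmonic_triangle:
  assumes "k \<le> m"
  shows "1 / real (Suc (Suc m) * (Suc m choose Suc k)) =
    1 / real (Suc m * (m choose k)) - 1 / real (Suc (Suc m) * (Suc m choose k))"
proof -
  define d where "d = m - k"
  have m: "m = k + d"
    using assms by (simp add: d_def)
  have "Suc k * (Suc m choose Suc k) = Suc m * (m choose k)"
    by (rule Suc_times_binomial)
  hence "(real k + 1) * real (Suc m choose Suc k) = (real m + 1) * real (m choose k)"
    by (metis of_nat_Suc of_nat_mult add.commute)
  hence B: "real (Suc m choose Suc k) = (real m + 1) * real (m choose k) / (real k + 1)"
    by (simp add: field_simps del: binomial_Suc_Suc)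
  have "(Suc m - k) * (Suc m choose k) = Suc m * (m choose k)"
    using binomial_absorb_comp[of "Suc m" k] by simp
  hence "Suc d * (Suc m choose k) = Suc m * (m choose k)"
    by (simp add: m Suc_diff_le)
  hence "(real d + 1) * real (Suc m choose k) = (real m + 1) * real (m choose k)"
    by (metis of_nat_Suc of_nat_mult add.commute)
  hence C: "real (Suc m choose k) = (real m + 1) * real (m choose k) / (real d + 1)"
    by (simp add: field_simps)
  have "1 / real (Suc (Suc m) * (Suc m choose Suc k)) + 1 / real (Suc (Suc m) * (Suc m choose k))
      = ((real k + 1) + (real d + 1)) / ((real m + 2) * ((real m + 1) * real (m choose k)))"
    unfolding of_nat_mult B C by (simp add: add_divide_distrib add.commute)
  also have "\<dots> = 1 / real (Suc m * (m choose k))"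
  proof -
    have "(real k + 1) + (real d + 1) = real m + 2"
      by (simp add: m)
    moreover have "real (Suc m * (m choose k)) = (real m + 1) * real (m choose k)"
      by (simp add: distrib_right)
    moreover have "real m + 2 \<noteq> 0"
      by linarith
    ultimately show ?thesis
      by (simp only: nonzero_divide_mult_cancel_left not_False_eq_True)
  qed
  finally show ?thesis
    by linarith
qed

lemma Suc_mult_binomial_dvd:
  fixes L :: nat
  assumes "\<And>i. i \<in> {1..Suc m} \<Longrightarrow> i dvd L" and "k \<le> m"
  shows "Suc m * (m choose k) dvd L"
proof -
  \<comment> \<open>Integrality of a quotient replaces divisibility because it is closed under the
    differences in the triangle's recurrence.\<close>
  have "real L / real (Suc m * (m choose k)) \<in> \<int>"
    using assms
  proof (induction k arbitrary: m)
    case 0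
    hence "Suc m dvd L"
      by simp
    then obtain j where "L = Suc m * j" ..
    hence "real L / real (Suc m * (m choose 0)) = real j"
      by (simp del: of_nat_Suc mult_Suc)
    thus ?case
      by (metis Ints_of_nat)
  next
    case (Suc k)
    then obtain p where m: "m = Suc p" and kp: "k \<le> p"
      by (cases m) auto
    have "real L / real (Suc m * (m choose Suc k)) =
        real L * (1 / real (Suc m * (m choose Suc k)))"
      by simp
    \<comment> \<open>Both entries lie in column \<open>k\<close>, in rows \<open>p\<close> and
      \<open>m\<close>, hence the induction on \<open>k\<close> with the row arbitrary.\<close>
    also have "\<dots> = real L / real (Suc p * (p choose k)) - real L / real (Suc m * (m choose k))"
      unfolding m leibniz_harmonic_triangle[OF kp] by (simp add: right_diff_distrib)
    also have "\<dots> \<in> \<int>"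
      using Suc.prems m kp by (intro Ints_diff Suc.IH) auto
    finally show ?case .
  qed
  then obtain z where "real L / real (Suc m * (m choose k)) = of_int z"
    by (auto elim: Ints_cases)
  moreover have "real (Suc m * (m choose k)) \<noteq> 0"
    using assms(2) by (simp del: of_nat_mult mult_Suc)
  ultimately have "real L = of_int z * real (Suc m * (m choose k))"
    by (metis nonzero_divide_eq_eq)
  hence "int L = z * int (Suc m * (m choose k))"
    by (metis of_int_eq_iff of_int_mult of_int_of_nat_eq)
  thus ?thesis
    by (metis dvd_triv_right of_nat_dvd_iff)
qed

theorem corollary3:
  fixes n :: nat
  assumes "n \<ge> 1"
  shows "Lcm {1..n} \<ge> 2 ^ (n - 1)"
proof -
  obtain m where n: "n = Suc m"
    using assms by (cases n) auto
  define L where "L = Lcm {1..n}"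
  \<comment> \<open>Divisibility bounds the divisor only for a nonzero multiple; 0 is not in the
    finite set \<open>{1..n}\<close>.\<close>
  have "L > 0"
    unfolding L_def by (intro Nat.gr0I) (auto simp: Lcm_0_iff)
  \<comment> \<open>The factor \<open>Suc m\<close> is also the number of summands, so it cancels at
    the end.\<close>
  have "Suc m * 2 ^ m = (\<Sum>k\<le>m. Suc m * (m choose k))"
    by (simp only: choose_row_sum[symmetric] sum_distrib_left)
  also have "\<dots> \<le> (\<Sum>k\<le>m. L)"
  proof (rule sum_mono)
    fix k assume "k \<in> {..m}"
    hence "Suc m * (m choose k) dvd L"
      unfolding L_def n by (intro Suc_mult_binomial_dvd dvd_Lcm) auto
    thus "Suc m * (m choose k) \<le> L"
      using \<open>L > 0\<close> by (rule dvd_imp_le)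
  qed
  also have "\<dots> = Suc m * L"
    by simp
  finally have "2 ^ m \<le> L"
    by (simp only: Suc_mult_le_cancel1)
  thus ?thesis
    by (simp add: L_def n)
qed

end
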